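(* Fix $p\in(0,1)$ and let $G_{n,p}$ be the Erdős–Rényi random graph on $n$ vertices (each possible edge present independently with probability $p$). Then asymptotically almost surely (i.e. with probability tending to $1$ as $n\to\infty$), $$ME(G_{n,p})=n^{3/2}p^{1/2}\left(\frac{8}{3\pi}+o(1)\right).$$
   Context: For a finite simple graph $G$ of order $n$, let $m_k(G)$ be the number of $k$-matchings (sets of $k$ pairwise disjoint edges) of $G$, with $m_0(G)=1$. The matching polynomial is $m(G,x)=\sum_{k=0}^{\lfloor n/2\rfloor}(-1)^k m_k(G)x^{n-2k}$; all its roots are real. The matching energy $ME(G)$ is the sum of the absolute values of the roots of $m(G,x)$ (counted with multiplicity). *)

theory Defs
  imports
    "HOL-Probability.Probability"
    "HOL-Computational_Algebra.Computational_Algebra"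
    "HOL-Library.Ramsey"
    "HOL-Library.Landau_Symbols"
begin

text \<open>
  A finite simple graph is given by a finite vertex set \<open>V\<close> and an edge set
  \<open>E \<subseteq> nsets V 2\<close>, i.e. edges are two-element subsets of \<open>V\<close>.
\<close>

definition k_matchings :: "'a set set \<Rightarrow> nat \<Rightarrow> 'a set set set" where
  "k_matchings E k = {M. M \<subseteq> E \<and> finite M \<and> card M = k \<and> pairwise disjnt M}"

definition num_k_matchings :: "'a set set \<Rightarrow> nat \<Rightarrow> nat" where
  "num_k_matchings E k = card (k_matchings E k)"

definition matching_poly :: "'a set \<Rightarrow> 'a set set \<Rightarrow> real poly" where
  "matching_poly V E =
     (\<Sum>k = 0..card V div 2. monom ((-1) ^ k * real (num_k_matchings E k)) (card V - 2 * k))"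

text \<open>
  The roots are taken in the complex numbers, so that the definition ranges over all of them
  without presupposing that they are real. The multiset \<open>proots\<close> accounts for multiplicity.
\<close>

definition matching_energy :: "'a set \<Rightarrow> 'a set set \<Rightarrow> real" where
  "matching_energy V E =
     (\<Sum>z \<in># proots (map_poly complex_of_real (matching_poly V E)). cmod z)"

text \<open>The random edge set of the Erdos--Renyi graph on the vertex set \<open>{..<n}\<close>.\<close>

definition random_graph :: "nat \<Rightarrow> real \<Rightarrow> nat set set pmf" where
  "random_graph n p =
     map_pmf (\<lambda>f. {e \<in> nsets {..<n} 2. f e})
       (Pi_pmf (nsets {..<n} 2) False (\<lambda>_. bernoulli_pmf p))"

end

theory Submission
  imports Defs "HOL-Real_Asymp.Real_Asymp"
begin

text \<open>
  Weight a matching \<open>M\<close> of \<open>G\<close> by \<open>Y ^ N\<close>, where \<open>N = n - 2|M|\<close> is the number of uncovered vertices.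
  The matching polynomial has real roots \<open>l\<^sub>i\<close> (Heilmann--Lieb), so \<open>E[N] = \<Sum> Y\<^sup>2 / (Y\<^sup>2 + l\<^sub>i\<^sup>2)\<close>
  and \<open>Var N \<le> n / 2\<close>. Adding one edge to a matching gives \<open>Y\<^sup>2 E|M| = E[e(U)]\<close>, where \<open>e(U)\<close>
  counts the edges inside the uncovered set. If every vertex set \<open>S\<close> spans
  \<open>p |S|\<^sup>2 / 2 + o(n\<^sup>2)\<close> edges, which fails with probability tending to \<open>0\<close> by Hoeffding's inequality
  and a union bound over the \<open>2 ^ n\<close> sets, then \<open>a = E[N] / n\<close> at \<open>Y = y \<surd>n\<close> satisfies
  \<open>y\<^sup>2 (1 - a) = p a\<^sup>2 + o(1)\<close>, the quadratic equation of the semicircle law. Finally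
  \<open>\<Sum>|l\<^sub>i| / n ^ (3/2) = (2 / \<pi>) \<integral> (1 - a) dy\<close> over the positive half line, and the error term is
  integrated using that it is at most \<open>1\<close> near \<open>0\<close> and \<open>O(1 / y\<^sup>2)\<close> elsewhere.
\<close>

subsection \<open>Matchings of induced subgraphs\<close>

text \<open>The edge set stays fixed while the vertex set shrinks, so vertex deletions in the
  recursion only change \<open>W\<close>.\<close>

definition matchings :: "'a set set \<Rightarrow> 'a set \<Rightarrow> 'a set set set" where
  "matchings E W = {M. M \<subseteq> E \<inter> Pow W \<and> pairwise disjnt M}"

text \<open>The partition function of the monomer-dimer model. The type is left open because complex
  \<open>z\<close> is used to locate roots and real \<open>z\<close> to weight matchings.\<close>

definition monomer_sum :: "'a set set \<Rightarrow> 'a set \<Rightarrow> 'b::comm_semiring_1 \<Rightarrow> 'b" where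
  "monomer_sum E W z = (\<Sum>M\<in>matchings E W. z ^ card (W - \<Union>M))"

lemma finite_matchings: "finite W \<Longrightarrow> finite (matchings E W)"
  by (rule finite_subset[of _ "Pow (Pow W)"]) (auto simp: matchings_def)

lemma finite_matching: "finite W \<Longrightarrow> M \<in> matchings E W \<Longrightarrow> finite M"
  by (rule finite_subset[of _ "Pow W"]) (auto simp: matchings_def)

lemma card_uncovered:
  assumes W: "finite W" and E: "\<And>e. e \<in> E \<Longrightarrow> card e = 2" and M: "M \<in> matchings E W"
  shows "card (W - \<Union>M) + 2 * card M = card W"
proof -
  have sub: "\<Union>M \<subseteq> W" using M by (auto simp: matchings_def)
  have "card (\<Union>M) = sum card M"
    using M by (intro card_Union_disjoint finite_subset[OF _ W]) (auto simp: matchings_def)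
  also have "\<dots> = sum (\<lambda>_. 2) M"
    using M E by (intro sum.cong) (auto simp: matchings_def)
  finally have c: "card (\<Union>M) = 2 * card M" by simp
  have "card (W - \<Union>M) = card W - card (\<Union>M)"
    using sub W finite_subset by (intro card_Diff_subset) auto
  moreover have "card (\<Union>M) \<le> card W" using sub W card_mono by blast
  ultimately show ?thesis using c by simp
qed

text \<open>Either \<open>v\<close> is uncovered and contributes a factor \<open>z\<close>, or it
  lies on exactly one edge \<open>e\<close> of the matching; removing \<open>e\<close> leaves a
  matching of \<open>W - e\<close> with the same uncovered set.\<close>

lemma monomer_sum_recurrence:
  assumes W: "finite W" and v: "v \<in> W" and E: "\<And>e. e \<in> E \<Longrightarrow> card e = 2"
  shows "monomer_sum E W z = z * monomer_sum E (W - {v}) z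
           + (\<Sum>e\<in>{e \<in> E \<inter> Pow W. v \<in> e}. monomer_sum E (W - e) z)"
proof -
  let ?I = "{e \<in> E \<inter> Pow W. v \<in> e}"
  have finI: "finite ?I" using W by (auto intro: finite_subset[of _ "Pow W"])
  have split: "matchings E W = matchings E (W - {v}) \<union> (\<Union>e\<in>?I. insert e ` matchings E (W - e))"
  proof (intro equalityI subsetI)
    fix M assume M: "M \<in> matchings E W"
    show "M \<in> matchings E (W - {v}) \<union> (\<Union>e\<in>?I. insert e ` matchings E (W - e))"
    proof (cases "v \<in> \<Union>M")
      case False
      then show ?thesis using M by (auto simp: matchings_def)
    next
      case True
      then obtain e where e: "e \<in> M" "v \<in> e" by auto
      have "M - {e} \<in> matchings E (W - e)"
        using M e by (auto simp: matchings_def pairwise_def disjnt_def; blast)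
      moreover have "M = insert e (M - {e})" using e by auto
      moreover have "e \<in> ?I" using M e by (auto simp: matchings_def)
      ultimately show ?thesis by blast
    qed
  next
    fix M assume "M \<in> matchings E (W - {v}) \<union> (\<Union>e\<in>?I. insert e ` matchings E (W - e))"
    then consider "M \<in> matchings E (W - {v})"
      | e M' where "e \<in> ?I" "M' \<in> matchings E (W - e)" "M = insert e M'" by blast
    then show "M \<in> matchings E W"
    proof cases
      case 1 then show ?thesis by (auto simp: matchings_def)
    next
      case 2
      then have "e \<inter> f = {}" if "f \<in> M'" for f
        using that unfolding matchings_def by blast
      then have "pairwise disjnt M"
        using 2 by (auto simp: matchings_def pairwise_insert disjnt_def Int_commute)
      then show ?thesis using 2 unfolding matchings_def by blast
    qed
  qed
  have e_notin: "e \<notin> M" if "e \<in> ?I" "M \<in> matchings E (W - e)" for e M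
    using that by (auto simp: matchings_def)
  have s1: "(\<Sum>M\<in>matchings E (W - {v}). z ^ card (W - \<Union>M)) = z * monomer_sum E (W - {v}) z"
    unfolding monomer_sum_def sum_distrib_left
  proof (intro sum.cong refl)
    fix M assume M: "M \<in> matchings E (W - {v})"
    have "W - \<Union>M = insert v (W - {v} - \<Union>M)" using M v by (auto simp: matchings_def)
    then have "card (W - \<Union>M) = Suc (card (W - {v} - \<Union>M))" using W by simp
    then show "z ^ card (W - \<Union>M) = z * z ^ card (W - {v} - \<Union>M)" by simp
  qed
  have s2: "(\<Sum>M\<in>insert e ` matchings E (W - e). z ^ card (W - \<Union>M)) = monomer_sum E (W - e) z"
    if e: "e \<in> ?I" for e
  proof -
    have "inj_on (insert e) (matchings E (W - e))"
      using e_notin[OF e] by (metis Diff_insert_absorb inj_onI)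
    then show ?thesis
      unfolding monomer_sum_def
      by (subst sum.reindex) (auto intro!: sum.cong simp: Diff_eq Int_assoc)
  qed
  have "monomer_sum E W z = (\<Sum>M\<in>matchings E (W - {v}). z ^ card (W - \<Union>M))
      + (\<Sum>M\<in>(\<Union>e\<in>?I. insert e ` matchings E (W - e)). z ^ card (W - \<Union>M))"
    unfolding monomer_sum_def split
    using W finI by (intro sum.union_disjoint)
      (auto intro!: finite_matchings simp: matchings_def)
  also have "(\<Sum>M\<in>(\<Union>e\<in>?I. insert e ` matchings E (W - e)). z ^ card (W - \<Union>M))
      = (\<Sum>e\<in>?I. \<Sum>M\<in>insert e ` matchings E (W - e). z ^ card (W - \<Union>M))"
  proof (rule sum.UNION_disjoint[OF finI])
    show "\<forall>e\<in>?I. finite (insert e ` matchings E (W - e))" using W by (auto intro: finite_matchings)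
    show "\<forall>e\<in>?I. \<forall>e'\<in>?I. e \<noteq> e' \<longrightarrow>
        insert e ` matchings E (W - e) \<inter> insert e' ` matchings E (W - e') = {}"
      by (fastforce simp: matchings_def)
  qed
  finally show ?thesis using s1 s2 by simp
qed

lemma monomer_sum_empty: "(\<And>e. e \<in> E \<Longrightarrow> card e = 2) \<Longrightarrow> monomer_sum E {} z = 1"
proof -
  assume E: "\<And>e. e \<in> E \<Longrightarrow> card e = 2"
  have "matchings E {} = {{}}" using E[of "{}"] by (auto simp: matchings_def)
  then show ?thesis by (simp add: monomer_sum_def)
qed

text \<open>The Heilmann--Lieb argument: the quotients in the second conjunct satisfy a continued-fraction
  recursion that preserves the right half plane.\<close>

lemma monomer_sum_right_half_plane:
  fixes z :: complex
  assumes "finite W" and E: "\<And>e. e \<in> E \<Longrightarrow> card e = 2" and z: "Re z > 0"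
  shows "monomer_sum E W z \<noteq> 0 \<and>
         (\<forall>v\<in>W. Re (monomer_sum E W z / monomer_sum E (W - {v}) z) \<ge> Re z)"
  using assms(1)
proof (induction W rule: finite_psubset_induct)
  case (psubset W)
  let ?m = "\<lambda>W. monomer_sum E W z"
  have step: "Re (?m W / ?m (W - {v})) \<ge> Re z" if v: "v \<in> W" for v
  proof -
    have IH: "?m (W - {v}) \<noteq> 0"
      "\<And>u. u \<in> W - {v} \<Longrightarrow> Re (?m (W - {v}) / ?m (W - {v} - {u})) \<ge> Re z"
      using psubset.IH[of "W - {v}"] v by auto
    have "?m W / ?m (W - {v}) = z + (\<Sum>e\<in>{e \<in> E \<inter> Pow W. v \<in> e}. ?m (W - e) / ?m (W - {v}))"
      using IH(1) by (subst monomer_sum_recurrence[OF psubset.hyps v E])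
        (auto simp: add_divide_distrib sum_divide_distrib)
    moreover have "Re (?m (W - e) / ?m (W - {v})) \<ge> 0" if e: "e \<in> E \<inter> Pow W" "v \<in> e" for e
    proof -
      obtain u where u: "e = {v, u}" "u \<noteq> v"
        using E[of e] e by (auto simp: card_2_iff doubleton_eq_iff)
      have We: "W - e = W - {v} - {u}" using u by auto
      have "u \<in> W - {v}" using u e by auto
      \<comment> \<open>\<open>W - e\<close> arises from \<open>W - {v}\<close> by deleting
        \<open>u\<close>, so the induction hypothesis controls this quotient; inversion maps the
        right half plane to itself.\<close>
      then have "Re (?m (W - {v}) / ?m (W - e)) > 0"
        unfolding We using IH(2) z less_le_trans by blast
      then have "Re (inverse (?m (W - {v}) / ?m (W - e))) \<ge> 0"
        by (simp only: inverse_complex.sel) (intro divide_nonneg_nonneg; simp)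
      then show ?thesis by simp
    qed
    ultimately show ?thesis by (auto intro!: sum_nonneg)
  qed
  moreover have "?m W \<noteq> 0"
  proof (cases "W = {}")
    case True then show ?thesis using monomer_sum_empty[of E z, OF E] by simp
  next
    case False
    then obtain v where "v \<in> W" by auto
    then have "Re (?m W / ?m (W - {v})) > 0" using step z by (meson less_le_trans)
    then show ?thesis by auto
  qed
  ultimately show ?case by blast
qed

text \<open>Both sides sum over pairs of a matching and an edge. On the left the edge belongs to the
  matching, on the right it can still be added; removing and inserting it are inverse
  bijections.\<close>

lemma matching_edge_double_count:
  fixes g :: "'a set \<Rightarrow> real"
  assumes W: "finite W" and E: "\<And>e. e \<in> E \<Longrightarrow> card e = 2"
  shows "(\<Sum>M\<in>matchings E W. real (card M) * g (W - \<Union>M)) =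
         (\<Sum>M\<in>matchings E W. \<Sum>e\<in>E \<inter> Pow (W - \<Union>M). g (W - \<Union>M - e))"
proof -
  have "(\<Sum>M\<in>matchings E W. real (card M) * g (W - \<Union>M)) =
        (\<Sum>(M, e)\<in>(SIGMA M:matchings E W. M). g (W - \<Union>M))"
    using W by (subst sum.Sigma[symmetric]) (auto intro: finite_matchings finite_matching)
  also have "\<dots> = (\<Sum>(M, e)\<in>(SIGMA M:matchings E W. E \<inter> Pow (W - \<Union>M)). g (W - \<Union>M - e))"
  proof (rule sum.reindex_bij_witness
      [of _ "\<lambda>(M, e). (insert e M, e)" "\<lambda>(M, e). (M - {e}, e)"], goal_cases)
    case (1 a) then show ?case by auto
  next
    case (2 a)
    then obtain M e where a: "a = (M, e)" "M \<in> matchings E W" "e \<in> M" by auto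
    have "e \<inter> f = {}" if "f \<in> M - {e}" for f
      using a that pairwiseD[of disjnt M e f] by (auto simp: matchings_def disjnt_def)
    then have "M - {e} \<in> matchings E W" "e \<in> E" "e \<subseteq> W - \<Union>(M - {e})"
      using a by (auto simp: matchings_def pairwise_def)
    then show ?case using a by simp
  next
    case (3 a)
    then obtain M e where a: "a = (M, e)" "M \<in> matchings E W" "e \<in> E" "e \<subseteq> W - \<Union>M" by auto
    have "e \<noteq> {}" using E a by fastforce
    then have "e \<notin> M" using a by blast
    then show ?case using a by auto
  next
    case (4 a)
    then obtain M e where a: "a = (M, e)" "M \<in> matchings E W" "e \<in> E" "e \<subseteq> W - \<Union>M" by auto
    then have "e \<inter> f = {}" if "f \<in> M" for f using that by blast
    then have "insert e M \<in> matchings E W"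
      using a by (auto simp: matchings_def pairwise_insert disjnt_def Int_commute)
    then show ?case using a by simp
  next
    case (5 a)
    then obtain M e where a: "a = (M, e)" "M \<in> matchings E W" "e \<in> M" by auto
    have "W - \<Union>(M - {e}) - e = W - \<Union>M" using a by auto
    then show ?case using a by simp
  qed
  also have "\<dots> = (\<Sum>M\<in>matchings E W. \<Sum>e\<in>E \<inter> Pow (W - \<Union>M). g (W - \<Union>M - e))"
    using W by (subst sum.Sigma) (auto intro: finite_matchings)
  finally show ?thesis .
qed

subsection \<open>The roots of the matching polynomial\<close>

text \<open>On the rotated variable the powers of \<open>\<i>\<close> cancel the alternating signs.
  A root \<open>z\<close> with \<open>Im z > 0\<close> thus corresponds to a zero
  \<open>w = - \<i> * z\<close> of the monomer sum with \<open>Re w > 0\<close>.\<close>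

lemma poly_matching_poly_conv_monomer_sum:
  assumes V: "finite V" and E: "E \<subseteq> nsets V 2"
  shows "poly (map_poly complex_of_real (matching_poly V E)) (\<i> * w) =
           \<i> ^ card V * monomer_sum E V w"
proof -
  let ?n = "card V"
  have E2: "card e = 2" "e \<subseteq> V" if "e \<in> E" for e using that E by (auto simp: nsets_def)
  have km: "k_matchings E k = {M \<in> matchings E V. card M = k}" for k
  proof -
    have "M \<subseteq> Pow V" if "M \<subseteq> E" for M using that E2(2) by blast
    then show ?thesis
      using finite_matching[OF V, of _ E] by (auto simp: k_matchings_def matchings_def)
  qed
  have cu: "card (V - \<Union>M) + 2 * card M = ?n" if "M \<in> matchings E V" for M
    using card_uncovered[OF V _ that] E2(1) by blast
  have hom: "map_poly complex_of_real (sum f K) = (\<Sum>k\<in>K. map_poly complex_of_real (f k))"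
    for f :: "nat \<Rightarrow> real poly" and K
    by (intro poly_eqI) (simp add: coeff_map_poly coeff_sum)
  have "poly (map_poly complex_of_real (matching_poly V E)) (\<i> * w) =
      (\<Sum>k = 0..?n div 2. (-1) ^ k * of_nat (card (k_matchings E k)) * (\<i> * w) ^ (?n - 2 * k))"
    by (simp add: matching_poly_def hom map_poly_monom poly_sum poly_monom num_k_matchings_def)
  also have "\<dots> = (\<Sum>k = 0..?n div 2. \<Sum>M | M \<in> matchings E V \<and> card M = k.
      (-1) ^ card M * (\<i> * w) ^ (?n - 2 * card M))"
    unfolding km by (intro sum.cong refl) (simp add: mult_ac)
  also have "\<dots> = (\<Sum>M\<in>matchings E V. (-1) ^ card M * (\<i> * w) ^ (?n - 2 * card M))"
    using cu V by (intro sum.group) (auto intro: finite_matchings; fastforce)+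
  also have "\<dots> = \<i> ^ ?n * monomer_sum E V w"
    unfolding monomer_sum_def sum_distrib_left
  proof (intro sum.cong refl)
    fix M assume M: "M \<in> matchings E V"
    have n: "?n = card (V - \<Union>M) + 2 * card M" using cu[OF M] by simp
    show "(-1) ^ card M * (\<i> * w) ^ (?n - 2 * card M) = \<i> ^ ?n * w ^ card (V - \<Union>M)"
      by (simp add: n power_add power_mult power_mult_distrib)
  qed
  finally show ?thesis .
qed

lemma matching_poly_monic:
  assumes V: "finite V"
  shows "degree (matching_poly V E) = card V" "lead_coeff (matching_poly V E) = 1"
proof -
  have "k_matchings E 0 = {{}}" by (auto simp: k_matchings_def)
  then have "coeff (matching_poly V E) (card V) = (\<Sum>k = 0..card V div 2. if k = 0 then 1 else 0)"
    unfolding matching_poly_def coeff_sum coeff_monom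
    by (intro sum.cong) (auto simp: num_k_matchings_def)
  then have c: "coeff (matching_poly V E) (card V) = 1" by simp
  moreover have "degree (matching_poly V E) \<le> card V"
    unfolding matching_poly_def
    by (intro degree_sum_le) (auto intro: order.trans[OF degree_monom_le])
  ultimately show d: "degree (matching_poly V E) = card V"
    by (metis le_antisym le_degree zero_neq_one)
  show "lead_coeff (matching_poly V E) = 1" using c d by simp
qed

text \<open>Real roots turn \<open>cmod\<close> into absolute values, and each linear factor at
  \<open>\<i> * y\<close> has squared modulus \<open>y\<^sup>2 + (l i)\<^sup>2\<close>. Squaring the
  sum avoids pairing each root with its negative.\<close>

lemma matching_roots:
  assumes V: "finite V" and E: "E \<subseteq> nsets V 2"
  obtains l :: "nat \<Rightarrow> real"
  where "matching_energy V E = (\<Sum>i<card V. \<bar>l i\<bar>)"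
    and "\<And>y. y > 0 \<Longrightarrow> (monomer_sum E V y)\<^sup>2 = (\<Prod>i<card V. y\<^sup>2 + (l i)\<^sup>2)"
proof -
  let ?q = "map_poly complex_of_real (matching_poly V E)"
  have E2: "card e = 2" "e \<subseteq> V" if "e \<in> E" for e using that E by (auto simp: nsets_def)
  have deg: "degree ?q = card V" and lead: "lead_coeff ?q = 1"
    using matching_poly_monic[OF V, of E] by (simp_all add: degree_map_poly coeff_map_poly)
  have root_upper: "Im z \<le> 0" if "poly ?q z = 0" for z
  proof (rule ccontr)
    assume "\<not> Im z \<le> 0"
    moreover have "z = \<i> * (- \<i> * z)" by simp
    ultimately show False
      using that poly_matching_poly_conv_monomer_sum[OF V E, of "- \<i> * z"]
        monomer_sum_right_half_plane[OF V E2(1), where z = "- \<i> * z"] by simp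
  qed
  \<comment> \<open>The coefficients are real, so excluding roots from the upper half plane also
    excludes them from the lower one.\<close>
  have cnj: "poly ?q (cnj z) = cnj (poly ?q z)" for z
    by (rule poly_cnj_real[symmetric]) (simp add: coeff_map_poly)
  have root_real: "Im z = 0" if "poly ?q z = 0" for z
    using root_upper[OF that] root_upper[of "cnj z"] that by (simp add: cnj)
  \<comment> \<open>A list enumeration of the multiset indexes the roots with multiplicity.\<close>
  obtain xs where xs: "mset xs = proots ?q" using ex_mset by blast
  have len: "length xs = card V"
    using size_proots_complex[of ?q] by (simp add: deg flip: xs)
  define l where "l i = Re (xs ! i)" for i
  have im: "Im (xs ! i) = 0" if "i < card V" for i
  proof (rule root_real)
    have "xs ! i \<in># proots ?q" using that by (simp add: len flip: xs)
    moreover have "?q \<noteq> 0" using lead by auto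
    ultimately show "poly ?q (xs ! i) = 0" by simp
  qed
  show thesis
  proof (rule that[of l])
    have "matching_energy V E = (\<Sum>z\<leftarrow>xs. cmod z)"
      unfolding matching_energy_def xs[symmetric] by (metis mset_map sum_mset_sum_list)
    also have "\<dots> = (\<Sum>i<card V. cmod (xs ! i))"
      by (simp add: sum_list_sum_nth len atLeast0LessThan)
    also have "\<dots> = (\<Sum>i<card V. \<bar>l i\<bar>)"
      by (intro sum.cong) (auto simp: l_def cmod_eq_Re im)
    finally show "matching_energy V E = (\<Sum>i<card V. \<bar>l i\<bar>)" .
  next
    fix y :: real assume "y > 0"
    have "poly ?q x = (\<Prod>z\<leftarrow>xs. x - z)" for x
    proof -
      have "?q = (\<Prod>z\<leftarrow>xs. [:- z, 1:])"
        using complex_poly_decompose_multiset[of ?q]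
        by (simp add: lead flip: xs) (metis mset_map prod_mset_prod_list)
      then have "poly ?q x = poly (\<Prod>z\<leftarrow>xs. [:- z, 1:]) x" by simp
      also have "\<dots> = (\<Prod>z\<leftarrow>xs. x - z)" by (induction xs) (auto simp: algebra_simps)
      finally show ?thesis .
    qed
    then have "\<i> ^ card V * complex_of_real (monomer_sum E V y) = (\<Prod>i<card V. \<i> * y - xs ! i)"
      using poly_matching_poly_conv_monomer_sum[OF V E, of "complex_of_real y"]
      by (simp add: prod.list_conv_set_nth len atLeast0LessThan monomer_sum_def)
    then have "cmod (\<i> ^ card V * complex_of_real (monomer_sum E V y)) ^ 2
        = (\<Prod>i<card V. cmod (\<i> * y - xs ! i) ^ 2)"
      by (simp add: prod_norm prod_power_distrib flip: prod_norm)
    also have "\<dots> = (\<Prod>i<card V. y\<^sup>2 + (l i)\<^sup>2)"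
      by (intro prod.cong) (auto simp: l_def cmod_power2 im)
    finally show "(monomer_sum E V y)\<^sup>2 = (\<Prod>i<card V. y\<^sup>2 + (l i)\<^sup>2)"
      by (simp add: norm_mult norm_power)
  qed
qed

subsection \<open>The number of uncovered vertices\<close>

text \<open>Unnormalised: dividing by the moment of index 0 gives the \<open>k\<close>-th moment of
  the number of uncovered vertices of a matching drawn with the weights of
  \<open>monomer_sum\<close>.\<close>

definition monomer_moment :: "nat \<Rightarrow> 'a set set \<Rightarrow> 'a set \<Rightarrow> real \<Rightarrow> real" where
  "monomer_moment k E W y =
     (\<Sum>M\<in>matchings E W. real (card (W - \<Union>M)) ^ k * y ^ card (W - \<Union>M))"

lemma monomer_moment_0: "monomer_moment 0 E W y = monomer_sum E W y"
  by (simp add: monomer_moment_def monomer_sum_def)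

lemma monomer_sum_pos:
  fixes y :: real
  assumes "finite W" "y > 0"
  shows "monomer_sum E W y > 0"
  unfolding monomer_sum_def
proof (rule sum_pos)
  show "matchings E W \<noteq> {}" by (auto simp: matchings_def intro!: exI[of _ "{}"])
qed (use assms in \<open>auto intro: finite_matchings\<close>)

text \<open>Differentiating \<open>y ^ N\<close> and multiplying by \<open>y\<close> brings down a
  factor \<open>N\<close>, which raises the index by one.\<close>

lemma has_derivative_monomer_moment:
  assumes "y > 0"
  shows "(monomer_moment k E W has_real_derivative monomer_moment (Suc k) E W y / y) (at y)"
proof -
  have *: "((\<lambda>y. real n ^ k * y ^ n) has_real_derivative real n ^ Suc k * y ^ n / y) (at y)" for n
    by (rule DERIV_cong[OF DERIV_cmult[OF DERIV_pow]]) (use assms in \<open>cases n; simp\<close>)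
  show ?thesis
    unfolding monomer_moment_def sum_divide_distrib by (intro DERIV_sum *)
qed

text \<open>The mean is \<open>y\<close> times the logarithmic derivative of \<open>Z\<close>, and
  the variance is \<open>y\<close> times the derivative of the mean. The factorization over real
  roots makes both explicit sums, with each variance term at most 1/2.\<close>

lemma monomer_mean_variance:
  fixes l :: "nat \<Rightarrow> real"
  assumes W: "finite W" and y: "y > 0"
    and fact: "\<And>y. y > 0 \<Longrightarrow> (monomer_sum E W y)\<^sup>2 = (\<Prod>i<n. y\<^sup>2 + (l i)\<^sup>2)"
  defines "Z \<equiv> monomer_moment 0 E W" and "S \<equiv> monomer_moment 1 E W" and "Q \<equiv> monomer_moment 2 E W"
  shows "S y / Z y = (\<Sum>i<n. y\<^sup>2 / (y\<^sup>2 + (l i)\<^sup>2))"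
    and "Q y / Z y - (S y / Z y)\<^sup>2 \<in> {0..real n / 2}"
proof -
  have Zpos: "Z y > 0" if "y > 0" for y
    using monomer_sum_pos[OF W that] by (simp add: Z_def monomer_moment_0)
  have pos: "y\<^sup>2 + (l i)\<^sup>2 > 0" if "y > 0" for y i using that by (simp add: add_pos_nonneg)
  have dZ: "(Z has_real_derivative S y / y) (at y)" if "y > 0" for y
    using has_derivative_monomer_moment[OF that, of 0] by (simp add: Z_def S_def)
  have dS: "(S has_real_derivative Q y / y) (at y)" if "y > 0" for y
    using has_derivative_monomer_moment[OF that, of 1] by (simp add: S_def Q_def numeral_2_eq_2)
  have mean: "S y / Z y = (\<Sum>i<n. y\<^sup>2 / (y\<^sup>2 + (l i)\<^sup>2))" if y: "y > 0" for y
  proof -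
    have ln_eq: "2 * ln (Z x) = (\<Sum>i<n. ln (x\<^sup>2 + (l i)\<^sup>2))" if "x > 0" for x
    proof -
      have "2 * ln (Z x) = ln ((Z x)\<^sup>2)" using Zpos[OF that] by (simp add: ln_realpow)
      also have "\<dots> = ln (\<Prod>i<n. x\<^sup>2 + (l i)\<^sup>2)"
        using fact[OF that] by (simp add: Z_def monomer_moment_0)
      also have "\<dots> = (\<Sum>i<n. ln (x\<^sup>2 + (l i)\<^sup>2))"
        using pos[OF that] by (intro ln_prod) auto
      finally show ?thesis .
    qed
    have "((\<lambda>x. \<Sum>i<n. ln (x\<^sup>2 + (l i)\<^sup>2)) has_real_derivative
        (\<Sum>i<n. 2 * y / (y\<^sup>2 + (l i)\<^sup>2))) (at y)"
      using pos[OF y] by (auto intro!: derivative_eq_intros sum.cong)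
    moreover have "((\<lambda>x. 2 * ln (Z x)) has_real_derivative 2 * (S y / y / Z y)) (at y)"
      using Zpos[OF y] by (auto intro!: derivative_eq_intros dZ y simp: mult_ac)
    then have "((\<lambda>x. \<Sum>i<n. ln (x\<^sup>2 + (l i)\<^sup>2)) has_real_derivative 2 * (S y / y / Z y)) (at y)"
      \<comment> \<open>The two functions agree only for positive arguments, hence on a
        neighbourhood of \<open>y\<close>.\<close>
      by (rule DERIV_cong_ev[THEN iffD1, rotated -1, OF _ refl _ refl])
        (use y ln_eq in \<open>auto intro!: eventually_mono[OF eventually_nhds_in_open[of "{0<..}"]]\<close>)
    ultimately have "2 * (S y / y / Z y) = (\<Sum>i<n. 2 * y / (y\<^sup>2 + (l i)\<^sup>2))"
      using DERIV_unique by blast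
    then have "y / 2 * (2 * (S y / y / Z y)) = (\<Sum>i<n. y\<^sup>2 / (y\<^sup>2 + (l i)\<^sup>2))"
      by (simp add: sum_distrib_left power2_eq_square)
    then show ?thesis using y by simp
  qed
  then show "S y / Z y = (\<Sum>i<n. y\<^sup>2 / (y\<^sup>2 + (l i)\<^sup>2))" using y .
  have "((\<lambda>x. \<Sum>i<n. x\<^sup>2 / (x\<^sup>2 + (l i)\<^sup>2)) has_real_derivative
      (\<Sum>i<n. 2 * y * (l i)\<^sup>2 / (y\<^sup>2 + (l i)\<^sup>2)\<^sup>2)) (at y)"
    using pos[OF y] less_imp_neq[OF pos[OF y]]
    by (auto intro!: derivative_eq_intros sum.cong simp: power2_eq_square algebra_simps)
  moreover have "((\<lambda>x. S x / Z x) has_real_derivative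
      (Q y / y * Z y - S y * (S y / y)) / (Z y * Z y)) (at y)"
    using Zpos[OF y] by (intro DERIV_divide dS dZ y) auto
  then have "((\<lambda>x. \<Sum>i<n. x\<^sup>2 / (x\<^sup>2 + (l i)\<^sup>2)) has_real_derivative
      (Q y / y * Z y - S y * (S y / y)) / (Z y * Z y)) (at y)"
    by (rule DERIV_cong_ev[THEN iffD1, rotated -1, OF _ refl _ refl])
      (use y mean in \<open>auto intro!: eventually_mono[OF eventually_nhds_in_open[of "{0<..}"]]\<close>)
  ultimately have "(Q y / y * Z y - S y * (S y / y)) / (Z y * Z y) =
      (\<Sum>i<n. 2 * y * (l i)\<^sup>2 / (y\<^sup>2 + (l i)\<^sup>2)\<^sup>2)"
    using DERIV_unique by blast
  moreover have "Q y / Z y - (S y / Z y)\<^sup>2 = y * ((Q y / y * Z y - S y * (S y / y)) / (Z y * Z y))"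
    using y Zpos[OF y] by (simp add: field_simps power2_eq_square)
  ultimately have var: "Q y / Z y - (S y / Z y)\<^sup>2 = (\<Sum>i<n. 2 * y\<^sup>2 * (l i)\<^sup>2 / (y\<^sup>2 + (l i)\<^sup>2)\<^sup>2)"
    by (simp add: sum_distrib_left power2_eq_square mult_ac)
  have "2 * y\<^sup>2 * (l i)\<^sup>2 / (y\<^sup>2 + (l i)\<^sup>2)\<^sup>2 \<le> 1 / 2" for i
  proof -
    \<comment> \<open>The arithmetic-geometric mean inequality for the two squares.\<close>
    have "4 * (y\<^sup>2 * (l i)\<^sup>2) \<le> (y\<^sup>2 + (l i)\<^sup>2)\<^sup>2"
      using zero_le_power2[of "y\<^sup>2 - (l i)\<^sup>2"] by (simp add: power2_eq_square algebra_simps)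
    then show ?thesis using pos[OF y, of i] by (intro mult_imp_div_pos_le zero_less_power) simp_all
  qed
  then have "(\<Sum>i<n. 2 * y\<^sup>2 * (l i)\<^sup>2 / (y\<^sup>2 + (l i)\<^sup>2)\<^sup>2) \<le> (\<Sum>i<n. 1 / 2)"
    by (intro sum_mono)
  then show "Q y / Z y - (S y / Z y)\<^sup>2 \<in> {0..real n / 2}"
    unfolding var by (auto intro!: sum_nonneg)
qed

text \<open>Double counting relates the mean size of a matching to the mean number of edges in its
  uncovered set. By \<open>disc\<close> the latter is \<open>p / 2\<close> times the mean of
  \<open>N * (N - 1)\<close> up to \<open>d\<close>, and \<open>2 * card M\<close> is
  \<open>card W - N\<close>; doubling gives \<open>2 * d\<close>.\<close>

lemma monomer_loop_equation:
  assumes W: "finite W" and E: "\<And>e. e \<in> E \<Longrightarrow> card e = 2" and y: "y > 0"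
    and disc: "\<And>S. S \<subseteq> W \<Longrightarrow> \<bar>real (card (E \<inter> Pow S)) - p * real (card S choose 2)\<bar> \<le> d"
  defines "Z \<equiv> monomer_moment 0 E W y" and "S \<equiv> monomer_moment 1 E W y"
    and "Q \<equiv> monomer_moment 2 E W y"
  shows "\<bar>y\<^sup>2 * (real (card W) - S / Z) - p * (Q / Z - S / Z)\<bar> \<le> 2 * d"
proof -
  let ?N = "\<lambda>M. card (W - \<Union>M)"
  have Zpos: "Z > 0" using monomer_sum_pos[OF W y] by (simp add: Z_def monomer_moment_0)
  \<comment> \<open>The double count is used with \<open>g U = y\<^sup>2 * y ^ card U\<close>; the
    factor \<open>y\<^sup>2\<close> makes up for the two vertices of the added edge.\<close>
  have "(\<Sum>M\<in>matchings E W. real (card M) * (y\<^sup>2 * y ^ ?N M)) =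
        (\<Sum>M\<in>matchings E W. \<Sum>e\<in>E \<inter> Pow (W - \<Union>M). y\<^sup>2 * y ^ card (W - \<Union>M - e))"
    by (rule matching_edge_double_count[OF W E])
  also have "\<dots> = (\<Sum>M\<in>matchings E W. real (card (E \<inter> Pow (W - \<Union>M))) * y ^ ?N M)"
  proof (intro sum.cong refl)
    fix M
    have "y\<^sup>2 * y ^ card (W - \<Union>M - e) = y ^ ?N M" if e: "e \<in> E \<inter> Pow (W - \<Union>M)" for e
    proof -
      have "finite e" "card e = 2" using E e by (auto intro: card_ge_0_finite)
      moreover have "card e \<le> ?N M" using e W by (intro card_mono) auto
      ultimately have "?N M = 2 + card (W - \<Union>M - e)"
        using e by (simp add: card_Diff_subset)
      then show ?thesis by (simp only: power_add)
    qed
    then show "(\<Sum>e\<in>E \<inter> Pow (W - \<Union>M). y\<^sup>2 * y ^ card (W - \<Union>M - e)) =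
        real (card (E \<inter> Pow (W - \<Union>M))) * y ^ ?N M" by simp
  qed
  finally have dc: "(\<Sum>M\<in>matchings E W. real (card M) * (y\<^sup>2 * y ^ ?N M)) =
    (\<Sum>M\<in>matchings E W. real (card (E \<inter> Pow (W - \<Union>M))) * y ^ ?N M)" .
  have "y\<^sup>2 * (real (card W) * Z - S) = 2 * (\<Sum>M\<in>matchings E W. real (card M) * (y\<^sup>2 * y ^ ?N M))"
    unfolding Z_def S_def monomer_moment_def sum_distrib_left sum_subtractf[symmetric]
  proof (intro sum.cong refl)
    fix M assume "M \<in> matchings E W"
    then have "real (card W) = real (?N M) + 2 * real (card M)"
      using card_uncovered[OF W E, of E M] by (metis of_nat_add of_nat_mult of_nat_numeral)
    then show "y\<^sup>2 * (real (card W) * (real (?N M) ^ 0 * y ^ ?N M) - real (?N M) ^ 1 * y ^ ?N M) =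
      2 * (real (card M) * (y\<^sup>2 * y ^ ?N M))" by (simp add: algebra_simps)
  qed
  also have "\<dots> = (\<Sum>M\<in>matchings E W. 2 * real (card (E \<inter> Pow (W - \<Union>M))) * y ^ ?N M)"
    unfolding dc by (simp add: sum_distrib_left mult_ac)
  finally have "y\<^sup>2 * (real (card W) * Z - S) - p * (Q - S) = (\<Sum>M\<in>matchings E W.
      (2 * real (card (E \<inter> Pow (W - \<Union>M))) - p * (real (?N M) ^ 2 - real (?N M))) * y ^ ?N M)"
    by (simp add: Q_def S_def monomer_moment_def sum_distrib_left algebra_simps
        flip: sum_subtractf sum.distrib)
  also have "\<bar>\<dots>\<bar> \<le> (\<Sum>M\<in>matchings E W. 2 * d * y ^ ?N M)"
  proof (intro order.trans[OF sum_abs] sum_mono)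
    fix M
    have "real (?N M choose 2) = (real (?N M) ^ 2 - real (?N M)) / 2"
      by (cases "?N M") (auto simp: choose_two real_of_nat_div algebra_simps power2_eq_square)
    then have "p * (real (?N M) ^ 2 - real (?N M)) = 2 * (p * real (?N M choose 2))" by simp
    then have "\<bar>2 * real (card (E \<inter> Pow (W - \<Union>M))) - p * (real (?N M) ^ 2 - real (?N M))\<bar>
        \<le> 2 * d"
      using disc[OF Diff_subset[of W "\<Union>M"]] by linarith
    then show "\<bar>(2 * real (card (E \<inter> Pow (W - \<Union>M))) - p * (real (?N M) ^ 2 - real (?N M))) *
        y ^ ?N M\<bar> \<le> 2 * d * y ^ ?N M"
      using y by (simp add: abs_mult mult_right_mono)
  qed
  also have "\<dots> = 2 * d * Z" by (simp add: Z_def monomer_moment_def sum_distrib_left)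
  finally have "\<bar>y\<^sup>2 * (real (card W) * Z - S) - p * (Q - S)\<bar> / Z \<le> 2 * d"
    using Zpos by (simp add: field_simps)
  moreover have "y\<^sup>2 * (real (card W) - S / Z) - p * (Q / Z - S / Z) =
      (y\<^sup>2 * (real (card W) * Z - S) - p * (Q - S)) / Z"
    using Zpos by (simp add: field_simps)
  ultimately show ?thesis using Zpos by simp
qed

subsection \<open>Primitives and the semicircle law\<close>

text \<open>The integral of the minimum of 1 and \<open>\<eta> / y\<^sup>2\<close> over the half
  line is \<open>2 * sqrt \<eta>\<close>. The mean value theorem and monotonicity take the place of
  integration.\<close>

lemma limit_bound_of_deriv_bounds:
  fixes D D' :: "real \<Rightarrow> real"
  assumes cont: "continuous_on {0..} D"
    and deriv: "\<And>y. y > 0 \<Longrightarrow> (D has_real_derivative D' y) (at y)"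
    and small: "\<And>y. y > 0 \<Longrightarrow> \<bar>D' y\<bar> \<le> 1"
    and large: "\<And>y. y > 0 \<Longrightarrow> \<bar>D' y\<bar> * y\<^sup>2 \<le> \<eta>"
    and \<eta>: "\<eta> > 0" and lim: "(D \<longlongrightarrow> L) at_top"
  shows "\<bar>L - D 0\<bar> \<le> 2 * sqrt \<eta>"
proof -
  \<comment> \<open>The two derivative bounds agree at \<open>s\<close>, and each side of it
    contributes \<open>s\<close>.\<close>
  define s where "s = sqrt \<eta>"
  have s: "s > 0" "\<eta> / s = s" using \<eta> by (simp_all add: s_def real_div_sqrt)
  have near: "\<bar>D s - D 0\<bar> \<le> s"
  proof -
    have "continuous_on {0..s} D" by (rule continuous_on_subset[OF cont]) auto
    moreover have "D differentiable (at x)" if "0 < x" "x < s" for x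
      using deriv[OF that(1)] real_differentiable_def by blast
    ultimately obtain l z where z: "0 < z" "(D has_real_derivative l) (at z)" "D s - D 0 = (s - 0) * l"
      using MVT[of 0 s D] s by auto
    then have "l = D' z" using deriv DERIV_unique by blast
    then have "\<bar>D s - D 0\<bar> = s * \<bar>D' z\<bar>" using z s by (simp add: abs_mult)
    also have "\<dots> \<le> s" using small[OF z(1)] s by (simp add: mult_le_cancel_left1)
    finally show ?thesis .
  qed
  have dbound: "\<bar>D' y\<bar> \<le> \<eta> / y\<^sup>2" if "y > 0" for y
    using large[OF that] that by (simp add: field_simps)
  have far: "\<bar>D R - D s\<bar> \<le> s" if R: "R \<ge> s" for R
  proof -
    \<comment> \<open>Adding \<open>\<eta> / y\<close> to \<open>D\<close> makes it nonincreasing,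
      and subtracting it makes it nondecreasing.\<close>
    have dinv: "((\<lambda>y. \<eta> / y) has_real_derivative - (\<eta> / y\<^sup>2)) (at y)" if "y > 0" for y
      using that by (auto intro!: derivative_eq_intros simp: power2_eq_square)
    have "D R + \<eta> / R \<le> D s + \<eta> / s"
    proof (rule DERIV_nonpos_imp_nonincreasing[OF R])
      fix y assume "s \<le> y"
      then have y: "y > 0" using s by simp
      show "\<exists>f'. ((\<lambda>y. D y + \<eta> / y) has_real_derivative f') (at y) \<and> f' \<le> 0"
        using DERIV_add[OF deriv[OF y] dinv[OF y]] dbound[OF y]
        by (intro exI[of _ "D' y + - (\<eta> / y\<^sup>2)"]) auto
    qed
    moreover have "D s - \<eta> / s \<le> D R - \<eta> / R"
    proof (rule DERIV_nonneg_imp_nondecreasing[OF R])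
      fix y assume "s \<le> y"
      then have y: "y > 0" using s by simp
      show "\<exists>f'. ((\<lambda>y. D y - \<eta> / y) has_real_derivative f') (at y) \<and> f' \<ge> 0"
        using DERIV_diff[OF deriv[OF y] dinv[OF y]] dbound[OF y]
        by (intro exI[of _ "D' y - - (\<eta> / y\<^sup>2)"]) auto
    qed
    moreover have "\<eta> / R \<ge> 0" using R s \<eta> by simp
    ultimately show ?thesis using s by auto
  qed
  have "\<bar>D R - D 0\<bar> \<le> 2 * s" if "R \<ge> s" for R using near far[OF that] by linarith
  moreover have "((\<lambda>R. \<bar>D R - D 0\<bar>) \<longlongrightarrow> \<bar>L - D 0\<bar>) at_top" by (intro tendsto_intros lim)
  ultimately have "\<bar>L - D 0\<bar> \<le> 2 * s"
    by (intro tendsto_upperbound[where F = at_top]) (auto intro: eventually_mono[OF eventually_ge_at_top[of s]])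
  then show ?thesis by (simp add: s_def)
qed

text \<open>A primitive of \<open>m\<^sup>2 / (y\<^sup>2 + m\<^sup>2)\<close> that recovers the
  absolute value of \<open>m\<close> from its total increase, as in Coulson's integral formula. For
  \<open>m = 0\<close> it is the zero function.\<close>

definition arctan_primitive :: "real \<Rightarrow> real \<Rightarrow> real" where
  "arctan_primitive m y = \<bar>m\<bar> * arctan (y / \<bar>m\<bar>)"

lemma arctan_primitive_0 [simp]: "arctan_primitive m 0 = 0"
  by (simp add: arctan_primitive_def)

lemma continuous_arctan_primitive: "continuous_on A (arctan_primitive m)"
  unfolding arctan_primitive_def
  by (cases "m = 0") (auto intro!: continuous_intros)

lemma has_derivative_arctan_primitive:
  assumes "y > 0"
  shows "(arctan_primitive m has_real_derivative 1 - y\<^sup>2 / (y\<^sup>2 + m\<^sup>2)) (at y)"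
proof (cases "m = 0")
  case True
  then show ?thesis using assms by (simp add: arctan_primitive_def[abs_def])
next
  case False
  have "y\<^sup>2 + m\<^sup>2 > 0" using assms by (simp add: add_pos_nonneg)
  then show ?thesis
    unfolding arctan_primitive_def[abs_def] using False
    by (auto intro!: derivative_eq_intros simp: divide_simps power2_eq_square)
qed

lemma tendsto_arctan_primitive: "(arctan_primitive m \<longlongrightarrow> pi / 2 * \<bar>m\<bar>) at_top"
proof (cases "m = 0")
  case True
  then show ?thesis by (simp add: arctan_primitive_def[abs_def])
next
  case False
  define c where "c = \<bar>m\<bar>"
  have "c > 0" using False by (simp add: c_def)
  then have "((\<lambda>y. c * arctan (y / c)) \<longlongrightarrow> pi / 2 * c) at_top" by real_asymp
  then show ?thesis by (simp add: arctan_primitive_def[abs_def] c_def)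
qed

text \<open>A primitive of \<open>1 - a\<close>, where \<open>a\<close> is the nonnegative solution of
  \<open>y\<^sup>2 (1 - a) = p a\<^sup>2\<close>; its total increase is \<open>\<pi> / 2\<close> times the first absolute moment of the
  semicircle law of variance \<open>p\<close>.\<close>

definition semicircle_primitive :: "real \<Rightarrow> real \<Rightarrow> real" where
  "semicircle_primitive p y = y + y ^ 3 / (6 * p) - sqrt (y\<^sup>2 + 4 * p) ^ 3 / (6 * p)"

text \<open>The quadratic formula for the nonnegative root of
  \<open>p * a\<^sup>2 + y\<^sup>2 * a - y\<^sup>2\<close>, for \<open>y > 0\<close>, with
  \<open>y\<close> pulled out of the square root.\<close>

definition semicircle_fraction :: "real \<Rightarrow> real \<Rightarrow> real" where
  "semicircle_fraction p y = y * (sqrt (y\<^sup>2 + 4 * p) - y) / (2 * p)"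

lemma semicircle_fraction:
  assumes p: "p > 0" and y: "y > 0"
  defines "a \<equiv> semicircle_fraction p y"
  shows "y\<^sup>2 * (1 - a) = p * a\<^sup>2" and "a \<in> {0..1}"
    and "(semicircle_primitive p has_real_derivative 1 - a) (at y)"
proof -
  define w where "w = sqrt (y\<^sup>2 + 4 * p)"
  have wpos: "y\<^sup>2 + 4 * p > 0" using p by (simp add: add_nonneg_pos)
  have w2: "w\<^sup>2 = y\<^sup>2 + 4 * p" using wpos by (simp add: w_def)
  have a: "a = y * (w - y) / (2 * p)" by (simp add: a_def semicircle_fraction_def w_def)
  have "w \<ge> y" using p y by (auto simp: w_def intro!: real_le_rsqrt)
  then have a0: "a \<ge> 0" using y p by (simp add: a)
  have "4 * p * (p * a\<^sup>2) = y\<^sup>2 * (w - y)\<^sup>2" using p by (simp add: a field_simps power2_eq_square)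
  also have "(w - y)\<^sup>2 = 2 * y\<^sup>2 + 4 * p - 2 * w * y" using w2 by (simp add: power2_eq_square algebra_simps)
  also have "y\<^sup>2 * \<dots> = 4 * p * (y\<^sup>2 * (1 - a))" using p by (simp add: a field_simps power2_eq_square)
  finally show eq: "y\<^sup>2 * (1 - a) = p * a\<^sup>2" using p by simp
  \<comment> \<open>The upper bound on \<open>a\<close> is read off from the sign of the right-hand
    side of the equation.\<close>
  then have "y\<^sup>2 * (1 - a) \<ge> 0" using p by simp
  then have "a \<le> 1" using y by (simp add: zero_le_mult_iff)
  then show "a \<in> {0..1}" using a0 by simp
  have dw: "((\<lambda>y. sqrt (y\<^sup>2 + 4 * p)) has_real_derivative y / w) (at y)"
    using wpos by (auto intro!: derivative_eq_intros simp: w_def field_simps)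
  have wp: "w > 0" using wpos by (simp add: w_def)
  have "(semicircle_primitive p has_real_derivative
      1 + real 3 * y ^ (3 - Suc 0) / (6 * p) - real 3 * (y / w * w ^ (3 - Suc 0)) / (6 * p)) (at y)"
    unfolding semicircle_primitive_def[abs_def] w_def[symmetric]
    by (intro DERIV_diff DERIV_add DERIV_ident DERIV_cdivide DERIV_pow
        DERIV_cong[OF DERIV_power[OF dw]]) (simp add: w_def)
  moreover have "1 + real 3 * y ^ (3 - Suc 0) / (6 * p) - real 3 * (y / w * w ^ (3 - Suc 0)) / (6 * p) = 1 - a"
    using p wp by (simp add: a field_simps power2_eq_square)
  ultimately show "(semicircle_primitive p has_real_derivative 1 - a) (at y)" by (simp only:)
qed

text \<open>The cube of \<open>sqrt (4 * p)\<close> divided by \<open>6 * p\<close>; multiplied by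
  \<open>2 / pi\<close> it yields the constant \<open>8 / (3 * pi)\<close>.\<close>

lemma semicircle_primitive_0: "p > 0 \<Longrightarrow> semicircle_primitive p 0 = - (4 / 3 * sqrt p)"
  by (simp add: semicircle_primitive_def real_sqrt_mult power3_eq_cube field_simps)

lemma continuous_semicircle_primitive: "p > 0 \<Longrightarrow> continuous_on A (semicircle_primitive p)"
  unfolding semicircle_primitive_def by (intro continuous_intros) auto

text \<open>The cube of \<open>sqrt (y\<^sup>2 + 4 * p)\<close> expands as
  \<open>y ^ 3 + 6 * p * y\<close> plus a term of order \<open>1 / y\<close>, which cancels the
  polynomial part.\<close>

lemma tendsto_semicircle_primitive:
  assumes "p > 0" shows "(semicircle_primitive p \<longlongrightarrow> 0) at_top"
  unfolding semicircle_primitive_def using assms by real_asymp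

subsection \<open>Matching energy and edge discrepancy\<close>

text \<open>The deterministic half. The rescaled mean \<open>a\<close> and the semicircle fraction
  solve the same quadratic equation up to \<open>\<eta>\<close>; the difference \<open>D\<close> of
  their primitives starts at \<open>4 / 3 * sqrt p\<close> and tends to \<open>pi / 2\<close> times
  the normalized energy.\<close>

lemma matching_energy_bound:
  assumes V: "finite V" "V \<noteq> {}" and E: "E \<subseteq> nsets V 2" and p: "0 < p" "p \<le> 1" and \<delta>: "\<delta> \<ge> 0"
    and disc: "\<And>S. S \<subseteq> V \<Longrightarrow>
      \<bar>real (card (E \<inter> Pow S)) - p * real (card S choose 2)\<bar> \<le> \<delta> * (real (card V))\<^sup>2"
  shows "\<bar>matching_energy V E / real (card V) powr (3 / 2) - 8 / (3 * pi) * sqrt p\<bar>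
           \<le> 4 / pi * sqrt (1 / real (card V) + 2 * \<delta>)"
proof -
  define n where "n = card V"
  have n: "n > 0" using V by (simp add: n_def card_gt_0_iff)
  have E2: "card e = 2" if "e \<in> E" for e using that E by (auto simp: nsets_def)
  \<comment> \<open>The term \<open>1 / n\<close> absorbs the variance and the linear part of
    \<open>N * (N - 1)\<close>; the rest is the doubled discrepancy.\<close>
  define \<eta> where "\<eta> = 1 / real n + 2 * \<delta>"
  have \<eta>: "\<eta> > 0" using n \<delta> by (auto simp: \<eta>_def intro!: add_pos_nonneg)
  obtain l where energy: "matching_energy V E = (\<Sum>i<n. \<bar>l i\<bar>)"
    and fact: "\<And>y::real. y > 0 \<Longrightarrow> (monomer_sum E V y)\<^sup>2 = (\<Prod>i<n. y\<^sup>2 + (l i)\<^sup>2)"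
    using matching_roots[OF V(1) E] unfolding n_def by metis
  define m where "m i = l i / sqrt (real n)" for i
  define a where "a y = (\<Sum>i<n. y\<^sup>2 / (y\<^sup>2 + (m i)\<^sup>2)) / real n" for y
  define D where "D y = (\<Sum>i<n. arctan_primitive (m i) y) / real n - semicircle_primitive p y" for y
  let ?b = "semicircle_fraction p"
  have a01: "a y \<in> {0..1}" if "y > 0" for y
  proof -
    have "(\<Sum>i<n. y\<^sup>2 / (y\<^sup>2 + (m i)\<^sup>2)) \<le> (\<Sum>i<n. 1)"
      using that by (intro sum_mono) (simp add: divide_le_eq_1 add_pos_nonneg)
    then show ?thesis using n by (auto simp: a_def intro!: divide_nonneg_nonneg sum_nonneg)
  qed
  have loop: "\<bar>y\<^sup>2 * (1 - a y) - p * (a y)\<^sup>2\<bar> \<le> \<eta>" if y: "y > 0" for y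
  proof -
    define Y where "Y = sqrt (real n) * y"
    have Y: "Y > 0" "Y\<^sup>2 = n * y\<^sup>2" using y n by (simp_all add: Y_def power_mult_distrib)
    define A where "A = monomer_moment 1 E V Y / monomer_moment 0 E V Y"
    define B where "B = monomer_moment 2 E V Y / monomer_moment 0 E V Y"
    define v where "v = B - A\<^sup>2"
    have "A = (\<Sum>i<n. Y\<^sup>2 / (Y\<^sup>2 + (l i)\<^sup>2))"
      unfolding A_def by (rule monomer_mean_variance(1)[OF V(1) Y(1) fact])
    also have "\<dots> = (\<Sum>i<n. y\<^sup>2 / (y\<^sup>2 + (m i)\<^sup>2))"
    proof (intro sum.cong refl)
      fix i
      have "Y\<^sup>2 + (l i)\<^sup>2 = n * (y\<^sup>2 + (m i)\<^sup>2)"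
        using n by (simp add: Y m_def power_divide algebra_simps)
      then show "Y\<^sup>2 / (Y\<^sup>2 + (l i)\<^sup>2) = y\<^sup>2 / (y\<^sup>2 + (m i)\<^sup>2)" using n by (simp add: Y)
    qed
    finally have A: "A = n * a y" using n by (simp add: a_def)
    have v: "v \<in> {0..real n / 2}"
      unfolding v_def A_def B_def by (rule monomer_mean_variance(2)[OF V(1) Y(1) fact])
    have "\<bar>Y\<^sup>2 * (real n - A) - p * (B - A)\<bar> \<le> 2 * (\<delta> * (real n)\<^sup>2)"
      using monomer_loop_equation[OF V(1) E2 Y(1) disc] by (simp add: A_def B_def n_def)
    \<comment> \<open>Replacing the second moment \<open>B\<close> by \<open>A\<^sup>2\<close> costs
      the variance \<open>v\<close>; the leading terms then scale with the square of
      \<open>n\<close>.\<close>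
    moreover have "Y\<^sup>2 * (real n - A) - p * (B - A) =
        (real n)\<^sup>2 * (y\<^sup>2 * (1 - a y) - p * (a y)\<^sup>2) - p * (v - A)"
      unfolding v_def Y(2) A by (simp add: power2_eq_square algebra_simps)
    moreover have "\<bar>p * (v - A)\<bar> \<le> real n"
    proof -
      have "0 \<le> A" "A \<le> n" using a01[OF y] n by (simp_all add: A mult_le_cancel_left1)
      then have "\<bar>v - A\<bar> \<le> n" using v by auto
      then have "p * \<bar>v - A\<bar> \<le> 1 * real n" using p by (intro mult_mono) auto
      then show ?thesis using p by (simp add: abs_mult)
    qed
    ultimately have "\<bar>(real n)\<^sup>2 * (y\<^sup>2 * (1 - a y) - p * (a y)\<^sup>2)\<bar> \<le> real n + 2 * (\<delta> * (real n)\<^sup>2)"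
      by linarith
    also have "\<dots> = (real n)\<^sup>2 * \<eta>" using n by (simp add: \<eta>_def power2_eq_square field_simps)
    finally show ?thesis using n by (simp add: abs_mult)
  qed
  have "\<bar>pi / 2 * (matching_energy V E / real n powr (3 / 2)) - D 0\<bar> \<le> 2 * sqrt \<eta>"
  proof (rule limit_bound_of_deriv_bounds[of D "\<lambda>y. ?b y - a y"])
    show "continuous_on {0..} D"
      unfolding D_def using p n
      by (intro continuous_intros continuous_arctan_primitive continuous_semicircle_primitive) auto
  next
    fix y :: real assume y: "y > 0"
    note b = semicircle_fraction[OF p(1) y]
    have "(\<Sum>i<n. 1 - y\<^sup>2 / (y\<^sup>2 + (m i)\<^sup>2)) / real n - (1 - ?b y) = ?b y - a y"
      using n by (simp add: a_def sum_subtractf diff_divide_distrib)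
    moreover have "(D has_real_derivative (\<Sum>i<n. 1 - y\<^sup>2 / (y\<^sup>2 + (m i)\<^sup>2)) / real n - (1 - ?b y)) (at y)"
      unfolding D_def using p y
      by (intro DERIV_diff DERIV_cdivide DERIV_sum has_derivative_arctan_primitive b)
    ultimately show "(D has_real_derivative ?b y - a y) (at y)" by (simp only:)
    show "\<bar>?b y - a y\<bar> \<le> 1" using b(2) a01[OF y] by auto
    \<comment> \<open>Subtracting the two quadratic equations leaves a factor of size at least
      \<open>y\<^sup>2\<close>, whence the decay of the error.\<close>
    have factor: "(?b y - a y) * (y\<^sup>2 + p * (a y + ?b y)) =
        (y\<^sup>2 * (1 - a y) - p * (a y)\<^sup>2) - (y\<^sup>2 * (1 - ?b y) - p * (?b y)\<^sup>2)"
      by (simp add: algebra_simps power2_eq_square)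
    have "\<bar>?b y - a y\<bar> * \<bar>y\<^sup>2 + p * (a y + ?b y)\<bar> \<le> \<eta>"
      unfolding abs_mult[symmetric] factor b(1) using loop[OF y] by simp
    moreover have "y\<^sup>2 \<le> \<bar>y\<^sup>2 + p * (a y + ?b y)\<bar>"
      using b(2) a01[OF y] p by (intro order.trans[OF _ abs_ge_self]) auto
    then have "\<bar>?b y - a y\<bar> * y\<^sup>2 \<le> \<bar>?b y - a y\<bar> * \<bar>y\<^sup>2 + p * (a y + ?b y)\<bar>"
      by (intro mult_left_mono) auto
    ultimately show "\<bar>?b y - a y\<bar> * y\<^sup>2 \<le> \<eta>" by linarith
  next
    have "real n powr (3 / 2) = real n powr (1 + 1 / 2)" by simp
    also have "\<dots> = real n * sqrt (real n)"
      using n by (subst powr_add) (simp add: powr_half_sqrt)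
    \<comment> \<open>The trailing 0 is the limit of \<open>semicircle_primitive\<close>, so the
      right-hand side matches \<open>D\<close> term by term.\<close>
    finally have "pi / 2 * (matching_energy V E / real n powr (3 / 2)) =
        (\<Sum>i<n. pi / 2 * \<bar>m i\<bar>) / real n - 0"
      by (simp add: energy m_def sum_distrib_left sum_divide_distrib field_simps)
    then show "(D \<longlongrightarrow> pi / 2 * (matching_energy V E / real n powr (3 / 2))) at_top"
      unfolding D_def using p n
      by (simp only:) (intro tendsto_intros tendsto_arctan_primitive tendsto_semicircle_primitive; simp)
  qed (fact \<eta>)
  moreover have "D 0 = 4 / 3 * sqrt p" using p by (simp add: D_def semicircle_primitive_0)
  ultimately have dev: "\<bar>pi / 2 * (matching_energy V E / real n powr (3 / 2)) - 4 / 3 * sqrt p\<bar> \<le> 2 * sqrt \<eta>"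
    by simp
  have rescale: "2 / pi * \<bar>pi / 2 * x - 4 / 3 * sqrt p\<bar> = \<bar>x - 8 / (3 * pi) * sqrt p\<bar>" for x
  proof -
    have "2 / pi * \<bar>pi / 2 * x - 4 / 3 * sqrt p\<bar> = \<bar>2 / pi * (pi / 2 * x - 4 / 3 * sqrt p)\<bar>"
      by (simp only: abs_mult) simp
    also have "2 / pi * (pi / 2 * x - 4 / 3 * sqrt p) = x - 8 / (3 * pi) * sqrt p"
      by (simp add: field_simps)
    finally show ?thesis .
  qed
  have "\<bar>matching_energy V E / real n powr (3 / 2) - 8 / (3 * pi) * sqrt p\<bar> \<le> 2 / pi * (2 * sqrt \<eta>)"
    unfolding rescale[symmetric] by (rule mult_left_mono[OF dev]) simp
  then show ?thesis by (simp add: n_def[symmetric] \<eta>_def)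
qed

section \<open>Uniform edge concentration in the random graph and the limit\<close>

text \<open>The edges inside a fixed \<open>S\<close> are binomially distributed, so Hoeffding's
  inequality applies to each \<open>S\<close>; the factor \<open>2 ^ n\<close> is the union
  bound.\<close>

lemma prob_discrepancy:
  assumes p: "0 < p" "p < 1" and \<delta>: "\<delta> \<ge> 0"
  shows "measure_pmf.prob (random_graph n p) {E. E \<subseteq> nsets {..<n} 2 \<and>
      (\<forall>S\<subseteq>{..<n}. \<bar>real (card (E \<inter> Pow S)) - p * real (card S choose 2)\<bar> \<le> \<delta> * (real n)\<^sup>2)}
    \<ge> 1 - 2 ^ n * (2 * exp (- 4 * \<delta>\<^sup>2 * (real n)\<^sup>2))"
proof -
  define P where "P = Pi_pmf (nsets {..<n} 2) False (\<lambda>_. bernoulli_pmf p)"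
  let ?bad = "\<lambda>S. {f. \<bar>real (card {e \<in> nsets S 2. f e}) - p * real (card S choose 2)\<bar> > \<delta> * (real n)\<^sup>2}"
  have bad: "measure_pmf.prob P (?bad S) \<le> 2 * exp (- 4 * \<delta>\<^sup>2 * (real n)\<^sup>2)" if S: "S \<subseteq> {..<n}" for S
  proof -
    have finS: "finite S" using S finite_subset by blast
    define N where "N = card S choose 2"
    have cN: "card (nsets S 2) = N"
      unfolding N_def n_subsets[OF finS, symmetric] nsets_def
      by (rule arg_cong[of _ _ card]) (use finS finite_subset in auto)
    \<comment> \<open>Hoeffding's exponent divides by \<open>N\<close>. If \<open>S\<close> contains
      no pair, both counts are 0 and the bad event is empty.\<close>
    show ?thesis
    proof (cases "N = 0")
      case True
      then have "nsets S 2 = {}" using cN finite_imp_finite_nsets[OF finS] by (metis card_0_eq)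
      then have "?bad S = {}" using True \<delta> by (simp add: N_def not_less binomial_eq_0)
      then show ?thesis by simp
    next
      case False
      \<comment> \<open>Only the coordinates inside \<open>S\<close> matter, so the product measure
        may be restricted to them.\<close>
      have "map_pmf (\<lambda>f. card {e \<in> nsets S 2. f e}) P =
          map_pmf (\<lambda>f. card {e \<in> nsets S 2. f e})
            (Pi_pmf (nsets S 2) False (\<lambda>_. bernoulli_pmf p))"
        unfolding P_def using S
        by (subst Pi_pmf_subset[of "nsets {..<n} 2" "nsets S 2"])
          (auto simp: nsets_mono finite_imp_finite_nsets map_pmf_comp intro!: map_pmf_cong arg_cong[of _ _ card])
      also have "\<dots> = binomial_pmf N p"
        by (rule binomial_pmf_altdef'[symmetric]) (use cN p finite_imp_finite_nsets[OF finS] in auto)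
      finally have dist: "map_pmf (\<lambda>f. card {e \<in> nsets S 2. f e}) P = binomial_pmf N p" .
      have "measure_pmf.prob P (?bad S) =
          measure_pmf.prob (binomial_pmf N p) {x. \<bar>real x - real N * p\<bar> > \<delta> * (real n)\<^sup>2}"
        unfolding dist[symmetric] by (simp add: N_def mult_ac vimage_def)
      also have "\<dots> \<le> measure_pmf.prob (binomial_pmf N p) {x. \<bar>real x - real N * p\<bar> \<ge> \<delta> * (real n)\<^sup>2}"
        by (intro measure_pmf.finite_measure_mono) auto
      also have "\<dots> \<le> 2 * exp (- 2 * (\<delta> * (real n)\<^sup>2)\<^sup>2 / N)"
        by (rule binomial_distribution.prob_abs_ge) (use False p \<delta> in \<open>auto simp: binomial_distribution_def\<close>)
      also have "\<dots> \<le> 2 * exp (- 4 * \<delta>\<^sup>2 * (real n)\<^sup>2)"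
      proof -
        \<comment> \<open>At most half of the square of \<open>n\<close> pairs lie in
          \<open>S\<close>, which turns the constant 2 in Hoeffding's exponent into 4.\<close>
        have "card S \<le> n" using S card_mono[of "{..<n}" S] by simp
        then have "card S * (card S - 1) \<le> n * n" by (intro mult_mono) auto
        then have "2 * N \<le> n * n" by (simp add: N_def choose_two)
        then have "real (2 * N) \<le> real (n * n)" by (simp only: of_nat_le_iff)
        then have "2 * real N \<le> (real n)\<^sup>2" by (simp add: power2_eq_square)
        then have "2 * \<delta>\<^sup>2 * (real n)\<^sup>2 * (2 * real N) \<le> 2 * \<delta>\<^sup>2 * (real n)\<^sup>2 * (real n)\<^sup>2"
          by (intro mult_left_mono) auto
        then have "4 * \<delta>\<^sup>2 * (real n)\<^sup>2 \<le> 2 * (\<delta> * (real n)\<^sup>2)\<^sup>2 / N"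
          using False by (simp add: field_simps power_mult_distrib power2_eq_square)
        then show ?thesis by simp
      qed
      finally show ?thesis .
    qed
  qed
  have "measure_pmf.prob P (\<Union>S\<in>Pow {..<n}. ?bad S) \<le> (\<Sum>S\<in>Pow {..<n}. measure_pmf.prob P (?bad S))"
    by (intro measure_pmf.finite_measure_subadditive_finite) auto
  also have "\<dots> \<le> (\<Sum>S\<in>Pow {..<n}. 2 * exp (- 4 * \<delta>\<^sup>2 * (real n)\<^sup>2))"
    by (intro sum_mono bad) auto
  also have "\<dots> = 2 ^ n * (2 * exp (- 4 * \<delta>\<^sup>2 * (real n)\<^sup>2))" by (simp add: card_Pow)
  finally have "1 - 2 ^ n * (2 * exp (- 4 * \<delta>\<^sup>2 * (real n)\<^sup>2)) \<le>
      measure_pmf.prob P (UNIV - (\<Union>S\<in>Pow {..<n}. ?bad S))"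
    by (subst measure_pmf.prob_compl[of _ P, simplified]) auto
  also have "\<dots> \<le> measure_pmf.prob P {f. \<forall>S\<subseteq>{..<n}.
      \<bar>real (card {e \<in> nsets S 2. f e}) - p * real (card S choose 2)\<bar> \<le> \<delta> * (real n)\<^sup>2}"
    by (intro measure_pmf.finite_measure_mono) (auto simp: not_less)
  also have "\<dots> = measure_pmf.prob (random_graph n p) {E. E \<subseteq> nsets {..<n} 2 \<and>
      (\<forall>S\<subseteq>{..<n}. \<bar>real (card (E \<inter> Pow S)) - p * real (card S choose 2)\<bar> \<le> \<delta> * (real n)\<^sup>2)}"
  proof -
    have "{e \<in> nsets {..<n} 2. f e} \<inter> Pow S = {e \<in> nsets S 2. f e}" if "S \<subseteq> {..<n}" for S f
      using that by (auto simp: nsets_def)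
    then have "(\<lambda>f. {e \<in> nsets {..<n} 2. f e}) -` {E. E \<subseteq> nsets {..<n} 2 \<and>
        (\<forall>S\<subseteq>{..<n}. \<bar>real (card (E \<inter> Pow S)) - p * real (card S choose 2)\<bar> \<le> \<delta> * (real n)\<^sup>2)} =
      {f. \<forall>S\<subseteq>{..<n}.
        \<bar>real (card {e \<in> nsets S 2. f e}) - p * real (card S choose 2)\<bar> \<le> \<delta> * (real n)\<^sup>2}"
      by auto
    then show ?thesis
      unfolding random_graph_def P_def measure_map_pmf by (simp only:)
  qed
  finally show ?thesis .
qed

theorem theorem2p3:
  fixes p :: real
  assumes "0 < p" and "p < 1"
  shows "\<exists>\<delta> :: nat \<Rightarrow> real. \<delta> \<in> o(\<lambda>_. 1) \<and>
    (\<lambda>n. measure_pmf.prob (random_graph n p)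
       {E. \<exists>r. \<bar>r\<bar> \<le> \<delta> n \<and>
            matching_energy {..<n} E = real n powr (3/2) * p powr (1/2) * (8 / (3 * pi) + r)})
      \<longlonglongrightarrow> 1"
proof -
  \<comment> \<open>Any exponent strictly between -1/2 and 0 would do: \<open>d\<close> tends to 0,
    while \<open>(d n)\<^sup>2 * (real n)\<^sup>2\<close> outgrows \<open>n\<close> and beats the
    factor \<open>2 ^ n\<close>.\<close>
  define d :: "nat \<Rightarrow> real" where "d n = real n powr (- 1 / 4)" for n
  \<comment> \<open>The deterministic bound divided by \<open>sqrt p\<close>, since the claim takes
    \<open>p powr (1/2)\<close> out of the bracket.\<close>
  define \<delta> where "\<delta> n = 4 / pi * sqrt (1 / real n + 2 * d n) / sqrt p" for n
  let ?good = "\<lambda>n. {E. \<exists>r. \<bar>r\<bar> \<le> \<delta> n \<and>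
    matching_energy {..<n} E = real n powr (3/2) * p powr (1/2) * (8 / (3 * pi) + r)}"
  have "\<delta> \<longlonglongrightarrow> 0" unfolding \<delta>_def d_def using assms by real_asymp
  then have "\<delta> \<in> o(\<lambda>_. 1)" by (auto intro: smalloI_tendsto)
  moreover have "(\<lambda>n. measure_pmf.prob (random_graph n p) (?good n)) \<longlonglongrightarrow> 1"
  proof (rule tendsto_sandwich[where h = "\<lambda>_. 1"])
    show "(\<lambda>n. 1 - 2 ^ n * (2 * exp (- 4 * (d n)\<^sup>2 * (real n)\<^sup>2))) \<longlonglongrightarrow> 1"
      unfolding d_def by real_asymp
    show "\<forall>\<^sub>F n in sequentially. 1 - 2 ^ n * (2 * exp (- 4 * (d n)\<^sup>2 * (real n)\<^sup>2))
        \<le> measure_pmf.prob (random_graph n p) (?good n)"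
      using eventually_gt_at_top[of 0]
    proof eventually_elim
      case (elim n)
      have d: "d n \<ge> 0" by (simp add: d_def)
      have "\<exists>r. \<bar>r\<bar> \<le> \<delta> n \<and>
          matching_energy {..<n} E = real n powr (3/2) * p powr (1/2) * (8 / (3 * pi) + r)"
        if E: "E \<subseteq> nsets {..<n} 2" and disc: "\<forall>S\<subseteq>{..<n}.
          \<bar>real (card (E \<inter> Pow S)) - p * real (card S choose 2)\<bar> \<le> d n * (real n)\<^sup>2" for E
      proof (intro exI conjI)
        \<comment> \<open>The witness for \<open>r\<close> is forced: it is
          \<open>x / sqrt p - 8 / (3 * pi)\<close>.\<close>
        define x where "x = matching_energy {..<n} E / real n powr (3 / 2)"
        have bound: "\<bar>x - 8 / (3 * pi) * sqrt p\<bar> \<le> 4 / pi * sqrt (1 / real n + 2 * d n)"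
          using matching_energy_bound[of "{..<n}" E p "d n"] E disc d assms elim
          by (auto simp: x_def)
        have "\<bar>x / sqrt p - 8 / (3 * pi)\<bar> = \<bar>x - 8 / (3 * pi) * sqrt p\<bar> / sqrt p"
        proof -
          have "x / sqrt p - 8 / (3 * pi) = (x - 8 / (3 * pi) * sqrt p) / sqrt p"
            using assms by (simp add: diff_divide_distrib)
          then show ?thesis using assms by (simp only: abs_divide) simp
        qed
        also have "\<dots> \<le> \<delta> n" unfolding \<delta>_def using assms bound by (intro divide_right_mono) auto
        finally show "\<bar>x / sqrt p - 8 / (3 * pi)\<bar> \<le> \<delta> n" .
        show "matching_energy {..<n} E =
            real n powr (3/2) * p powr (1/2) * (8 / (3 * pi) + (x / sqrt p - 8 / (3 * pi)))"
          using assms elim by (simp add: x_def powr_half_sqrt)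
      qed
      then show ?case
        by (intro order.trans[OF prob_discrepancy[OF assms d]] measure_pmf.finite_measure_mono) auto
    qed
  qed simp_all
  ultimately show ?thesis by blast
qed

end
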